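(* Let $P$ be a non-constant polynomial in one complex variable with complex coefficients. Then there exists a homeomorphism $h:\mathbb{C}\to\mathbb{C}$ of the plane (onto itself) such that $f=P\circ h:\mathbb{C}\to\mathbb{C}$ is a Lipschitz quotient mapping.
   Context: For metric spaces $X,Y$, $B^Z_s(z)$ denotes the open ball of radius $s>0$ centred at $z\in Z$, $Z=X,Y$. A mapping $f:X\to Y$ is a Lipschitz quotient mapping if there exist constants $0<c\le L<+\infty$ such that for every $x\in X$ and every $r>0$, $B^Y_{cr}(f(x))\subseteq f(B^X_r(x))\subseteq B^Y_{Lr}(f(x))$. The plane $\mathbb{C}$ is identified with $\mathbb{R}^2$; no particular norm is specified on the domain or codomain, since passing to equivalent norms does not affect whether a mapping is a Lipschitz quotient mapping (so one may use the Euclidean norm $|\cdot|$). *)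

theory Defs
  imports "HOL-Analysis.Analysis" "HOL-Computational_Algebra.Polynomial"
begin

definition lipschitz_quotient :: "('a::metric_space \<Rightarrow> 'b::metric_space) \<Rightarrow> bool" where
  "lipschitz_quotient f \<longleftrightarrow>
     (\<exists>c L :: real. 0 < c \<and> c \<le> L \<and>
        (\<forall>x. \<forall>r>0. ball (f x) (c * r) \<subseteq> f ` ball x r \<and> f ` ball x r \<subseteq> ball (f x) (L * r)))"

end

theory Submission
  imports Defs "HOL-Complex_Analysis.Conformal_Mappings"
    "HOL-Computational_Algebra.Fundamental_Theorem_Algebra"
begin

text \<open>
  Let \<open>A\<close> be the multiset of zeros of \<open>P'\<close>. Away from \<open>A\<close> the polynomial \<open>P\<close> is a local isometry
  from the plane with the conformal metric \<open>\<bar>P'(\<zeta>)\<bar> \<bar>d\<zeta>\<bar>\<close> to the Euclidean plane, and a zero of \<open>P'\<close>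
  is only a cone point of that metric, near which \<open>P\<close> still expands all distances from the cone
  point by a fixed factor. So if \<open>G\<close> is a bi-Lipschitz map from the plane with this metric onto the
  Euclidean plane, then \<open>P\<close> composed with the inverse of \<open>G\<close> is a Lipschitz quotient mapping.

  The metric itself never appears. Up to constant factors, the distance that it gives to \<open>y\<close> and \<open>z\<close>
  is \<open>t \<cdot> (\<Prod>a\<in>#A. t + dist z a)\<close> with \<open>t = dist y z\<close>, because along a typical path of length \<open>t\<close>
  between these points the factor \<open>\<bar>\<zeta> - a\<bar>\<close> of the density is comparable to \<open>t + dist z a\<close>. This
  quantity is the function \<open>chord\<close> below, and all estimates are two-point estimates with it.

  The map \<open>G\<close> is built by adding the zeros one at a time (\<open>chord_embedding\<close>). Given \<open>G\<close> for \<open>A\<close>, the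
  density has to be multiplied by \<open>\<bar>\<zeta> - a\<bar>\<close>. Composing \<open>G - G a\<close> with a radial map
  \<open>v \<mapsto> \<psi> (norm v) *\<^sub>R v\<close> multiplies lengths at \<open>v\<close> by about \<open>\<psi> (norm v)\<close>
  (\<open>radial_map_distortion\<close>). Since \<open>norm (G \<zeta> - G a)\<close> is comparable to \<open>chord A a (dist \<zeta> a)\<close>, the
  right choice for \<open>\<psi>\<close> is the inverse function of \<open>chord A a\<close>.

  For \<open>P\<close> itself, bounding \<open>P'\<close> on a disc gives \<open>dist (P y) (P z) \<le> C \<cdot> chord\<close> for all pairs
  (\<open>poly_dist_le_chord\<close>). The reverse bound fails globally unless \<open>P\<close> is injective, but it holds for
  \<open>y\<close> close to \<open>z\<close> with a constant that does not depend on \<open>z\<close> (\<open>chord_le_poly_dist_near\<close>). For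
  a continuous open map such a pointwise lower bound already yields the global inclusion of balls
  (\<open>local_to_global_co_lipschitz\<close>).
\<close>

section \<open>The distance function of a flat metric with cone points\<close>

text \<open>
  With \<open>t = dist y z\<close> this is, up to constant factors, the distance from \<open>y\<close> to \<open>z\<close> in the metric with
  density \<open>\<Prod>a\<in>#A. \<bar>\<zeta> - a\<bar>\<close>. It interpolates between the local behaviour, of order
  \<open>t ^ Suc (count A z)\<close>, and the behaviour \<open>t ^ Suc (size A)\<close> for large \<open>t\<close>.
\<close>

definition chord :: "complex multiset \<Rightarrow> complex \<Rightarrow> real \<Rightarrow> real" where
  "chord A z t = t * (\<Prod>a\<in>#A. t + dist z a)"

lemma prod_mset_image_nonneg:
  fixes f :: "'a \<Rightarrow> real"
  shows "(\<And>x. x \<in># A \<Longrightarrow> 0 \<le> f x) \<Longrightarrow> 0 \<le> (\<Prod>x\<in>#A. f x)"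
  by (induction A) auto

lemma prod_mset_image_pos:
  fixes f :: "'a \<Rightarrow> real"
  shows "(\<And>x. x \<in># A \<Longrightarrow> 0 < f x) \<Longrightarrow> 0 < (\<Prod>x\<in>#A. f x)"
  by (induction A) auto

lemma prod_mset_image_mono:
  fixes f g :: "'a \<Rightarrow> real"
  shows "(\<And>x. x \<in># A \<Longrightarrow> 0 \<le> f x \<and> f x \<le> g x) \<Longrightarrow> (\<Prod>x\<in>#A. f x) \<le> (\<Prod>x\<in>#A. g x)"
proof (induction A)
  case (add a A)
  then have "f a * (\<Prod>x\<in>#A. f x) \<le> g a * (\<Prod>x\<in>#A. g x)"
    by (intro mult_mono prod_mset_image_nonneg) force+
  then show ?case by simp
qed simp

lemma chord_0 [simp]: "chord A z 0 = 0"
  by (simp add: chord_def)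

lemma chord_pos: "0 < t \<Longrightarrow> 0 < chord A z t"
  unfolding chord_def by (intro mult_pos_pos prod_mset_image_pos) (auto simp: add_pos_nonneg)

lemma chord_add: "chord (add_mset a A) z t = (t + dist z a) * chord A z t"
  by (simp add: chord_def)

lemma continuous_on_chord: "continuous_on S (chord A z)"
proof -
  have "continuous_on S (\<lambda>t. (\<Prod>a\<in>#A. t + dist z a))"
    by (induction A) (auto intro!: continuous_intros)
  then show ?thesis
    unfolding chord_def by (intro continuous_intros)
qed

text \<open>
  Growth at least linear is what makes the inverse of \<open>chord A z\<close> grow at most linearly, so that
  constant factors in its argument become constant factors in its value.
\<close>

lemma chord_superhomogeneous:
  assumes "0 \<le> t" "1 \<le> l"
  shows "l * chord A z t \<le> chord A z (l * t)"
proof -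
  have "(\<Prod>a\<in>#A. t + dist z a) \<le> (\<Prod>a\<in>#A. l * t + dist z a)"
    using assms by (intro prod_mset_image_mono) (auto simp: mult_le_cancel_right1)
  then show ?thesis
    using assms by (simp add: chord_def mult.assoc mult_left_mono)
qed

section \<open>Radial maps\<close>

text \<open>
  Positivity and superhomogeneity force strict growth and unboundedness, so the intermediate value theorem gives
  an inverse on the half-line; applying monotonicity of the inverse to the superhomogeneity
  inequality shows that the inverse is subhomogeneous.
\<close>

lemma superhomogeneous_inverse:
  fixes \<theta> :: "real \<Rightarrow> real"
  assumes cont: "continuous_on UNIV \<theta>" and zero: "\<theta> 0 = 0"
    and pos: "\<And>t. 0 < t \<Longrightarrow> 0 < \<theta> t"
    and super: "\<And>t l. \<lbrakk>0 \<le> t; 1 \<le> l\<rbrakk> \<Longrightarrow> l * \<theta> t \<le> \<theta> (l * t)"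
  obtains \<psi> where "\<And>t. 0 \<le> t \<Longrightarrow> 0 \<le> \<psi> t" "\<And>t. 0 \<le> t \<Longrightarrow> \<psi> (\<theta> t) = t"
    "\<And>t. 0 \<le> t \<Longrightarrow> \<theta> (\<psi> t) = t"
    "\<And>s t. \<lbrakk>0 \<le> s; s \<le> t\<rbrakk> \<Longrightarrow> \<psi> s \<le> \<psi> t"
    "\<And>t l. \<lbrakk>0 \<le> t; 1 \<le> l\<rbrakk> \<Longrightarrow> \<psi> (l * t) \<le> l * \<psi> t"
proof -
  have strict: "\<theta> s < \<theta> t" if "0 \<le> s" "s < t" for s t
  proof (cases "s = 0")
    case False
    with that have "1 * \<theta> s < (t / s) * \<theta> s"
      by (intro mult_strict_right_mono pos) auto
    also have "\<dots> \<le> \<theta> (t / s * s)"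
      using that False by (intro super) auto
    finally show ?thesis using False by simp
  qed (use that zero pos in auto)
  have surj: "\<exists>s\<ge>0. \<theta> s = t" if "0 \<le> t" for t
  proof -
    define l where "l = max 1 (t / \<theta> 1)"
    have "t \<le> l * \<theta> 1"
      using pos[of 1] by (simp add: l_def max_def field_simps)
    also have "\<dots> \<le> \<theta> l"
      using super[of 1 l] by (simp add: l_def)
    finally have "\<exists>x\<ge>0. x \<le> l \<and> \<theta> x = t"
      using that zero by (intro IVT') (auto simp: l_def intro: continuous_on_subset[OF cont])
    then show ?thesis by blast
  qed
  define \<psi> where "\<psi> t = (SOME s. 0 \<le> s \<and> \<theta> s = t)" for t
  have \<psi>: "0 \<le> \<psi> t \<and> \<theta> (\<psi> t) = t" if "0 \<le> t" for t
    unfolding \<psi>_def by (rule someI_ex) (use surj[OF that] in blast)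
  have le: "s \<le> t" if "\<theta> s \<le> \<theta> t" "0 \<le> t" for s t
    using strict[of t s] that by (cases "s \<le> t") auto
  have nonneg: "0 \<le> \<theta> t" if "0 \<le> t" for t
    using pos[of t] zero that by (cases "t = 0") auto
  show thesis
  proof (rule that[of \<psi>])
    show "\<psi> (\<theta> t) = t" if "0 \<le> t" for t
      using \<psi>[OF nonneg[OF that]] that le[of "\<psi> (\<theta> t)" t] le[of t "\<psi> (\<theta> t)"] by simp
    show "\<psi> s \<le> \<psi> t" if "0 \<le> s" "s \<le> t" for s t
      using \<psi>[of s] \<psi>[of t] that le[of "\<psi> s" "\<psi> t"] by simp
    show "\<psi> (l * t) \<le> l * \<psi> t" if "0 \<le> t" "1 \<le> l" for t l
      using \<psi>[of t] \<psi>[of "l * t"] super[of "\<psi> t" l] that le[of "\<psi> (l * t)" "l * \<psi> t"]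
      by simp
  qed (use \<psi> in auto)
qed

text \<open>
  Let \<open>u\<close> be the shorter vector. Subhomogeneity of \<open>\<psi>\<close> says that \<open>\<psi> t / t\<close> decreases, so moving from
  \<open>norm u\<close> to \<open>norm v\<close> changes the factor \<open>\<psi>\<close> by an amount controlled by \<open>norm (u - v)\<close>; this gives
  the upper bound. For the lower bound, the radial map is monotone in the sense of inner products,
  because \<open>v\<close> and \<open>v - u\<close> form an angle of at most a right angle. This yields the smaller factor
  \<open>\<psi> (norm u)\<close>, which is comparable to the larger one unless \<open>v\<close> is much longer than \<open>u\<close>, and in that
  case comparing norms suffices.
\<close>

lemma radial_map_distortion:
  fixes \<psi> :: "real \<Rightarrow> real" and u v :: "'a::real_inner"
  assumes nonneg: "\<And>t. 0 \<le> t \<Longrightarrow> 0 \<le> \<psi> t"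
    and mono: "\<And>s t. \<lbrakk>0 \<le> s; s \<le> t\<rbrakk> \<Longrightarrow> \<psi> s \<le> \<psi> t"
    and sub: "\<And>t l. \<lbrakk>0 \<le> t; 1 \<le> l\<rbrakk> \<Longrightarrow> \<psi> (l * t) \<le> l * \<psi> t"
  defines "M \<equiv> \<psi> (max (norm u) (norm v))"
    and "D \<equiv> norm (\<psi> (norm u) *\<^sub>R u - \<psi> (norm v) *\<^sub>R v)"
  shows "M * norm (u - v) \<le> 4 * D" "D \<le> 2 * M * norm (u - v)"
proof -
  have main: "\<psi> (norm v) * norm (v - u) \<le> 4 * norm (\<psi> (norm v) *\<^sub>R v - \<psi> (norm u) *\<^sub>R u) \<and>
        norm (\<psi> (norm v) *\<^sub>R v - \<psi> (norm u) *\<^sub>R u) \<le> 2 * \<psi> (norm v) * norm (v - u)"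
    if uv: "norm u \<le> norm v" for u v :: 'a
  proof (cases "u = 0")
    case True
    then show ?thesis
      using nonneg[of "norm v"] by simp
  next
    case False
    define p q where "p = \<psi> (norm u)" and "q = \<psi> (norm v)"
    have pq: "0 \<le> p" "p \<le> q"
      using nonneg mono uv by (auto simp: p_def q_def)
    have "q \<le> (norm v / norm u) * p"
      using sub[of "norm u" "norm v / norm u"] uv False by (simp add: p_def q_def)
    then have ratio: "norm u * q \<le> norm v * p"
      using False by (simp add: field_simps)
    have tri: "norm v - norm u \<le> norm (v - u)" "norm (v - u) \<le> norm v + norm u"
      by (simp_all add: norm_triangle_ineq2 norm_triangle_ineq4)
    have eq: "q *\<^sub>R v - p *\<^sub>R u = q *\<^sub>R (v - u) + (q - p) *\<^sub>R u"
      "q *\<^sub>R v - p *\<^sub>R u = p *\<^sub>R (v - u) + (q - p) *\<^sub>R v"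
      by (simp_all add: algebra_simps)
    have "norm (q *\<^sub>R v - p *\<^sub>R u) \<le> q * norm (v - u) + (q - p) * norm u"
      unfolding eq(1) using pq by (intro order_trans[OF norm_triangle_ineq]) simp
    also have "(q - p) * norm u \<le> p * (norm v - norm u)"
      using ratio by (simp add: algebra_simps)
    also have "\<dots> \<le> q * norm (v - u)"
      using pq tri by (intro mult_mono) (use uv in auto)
    finally have upper: "norm (q *\<^sub>R v - p *\<^sub>R u) \<le> 2 * q * norm (v - u)" by simp
    have lower: "q * norm (v - u) \<le> 4 * norm (q *\<^sub>R v - p *\<^sub>R u)"
    proof (cases "norm v \<le> 2 * norm u")
      case True
      have "norm u * q \<le> norm u * (2 * p)"
        using ratio mult_right_mono[OF True pq(1)] by (simp add: algebra_simps)
      then have q2p: "q \<le> 2 * p"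
        using False by simp
      have "inner u v \<le> norm v * norm v"
        using norm_cauchy_schwarz[of u v] mult_right_mono[OF uv, of "norm v"] by simp
      then have "0 \<le> inner v (v - u)"
        by (simp add: inner_diff_right inner_commute power2_eq_square dot_square_norm)
      then have "p * norm (v - u) * norm (v - u) \<le> inner (q *\<^sub>R v - p *\<^sub>R u) (v - u)"
        unfolding eq(2) using pq
        by (simp add: inner_add_left power2_eq_square flip: power2_norm_eq_inner)
      also have "\<dots> \<le> norm (q *\<^sub>R v - p *\<^sub>R u) * norm (v - u)"
        by (rule norm_cauchy_schwarz)
      finally have "p * norm (v - u) \<le> norm (q *\<^sub>R v - p *\<^sub>R u)"
        by (cases "v = u") auto
      moreover have "q * norm (v - u) \<le> 2 * p * norm (v - u)"
        using q2p by (intro mult_right_mono) auto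
      ultimately show ?thesis
        using norm_ge_zero[of "q *\<^sub>R v - p *\<^sub>R u"] by linarith
    next
      case far: False
      have "q * norm v - p * norm u \<le> norm (q *\<^sub>R v - p *\<^sub>R u)"
        using norm_triangle_ineq2[of "q *\<^sub>R v" "p *\<^sub>R u"] pq by simp
      moreover have "p * norm u \<le> q * (norm v / 2)"
        using pq far by (intro mult_mono) auto
      moreover have "q * norm (v - u) \<le> q * (2 * norm v)"
        using pq tri uv by (intro mult_left_mono) auto
      ultimately show ?thesis by (simp add: algebra_simps)
    qed
    show ?thesis using upper lower by (simp add: p_def q_def)
  qed
  have "M * norm (u - v) \<le> 4 * D \<and> D \<le> 2 * M * norm (u - v)"
  proof (cases "norm u \<le> norm v")
    case True
    then show ?thesis using main[OF True]
      by (simp add: M_def D_def max_def norm_minus_commute)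
  next
    case False
    then show ?thesis using main[of v u]
      by (simp add: M_def D_def max_def)
  qed
  then show "M * norm (u - v) \<le> 4 * D" "D \<le> 2 * M * norm (u - v)" by auto
qed

section \<open>Flattening the cone metric\<close>

text \<open>
  In the induction step, the inverse \<open>\<psi>\<close> of \<open>chord A a\<close> turns \<open>dist (G y) (G a)\<close> back into \<open>dist y a\<close>, up
  to the constant \<open>K\<close>. The radial map therefore contributes the factor
  \<open>max (dist y a) (dist z a)\<close>, which is comparable to the new factor \<open>dist y z + dist z a\<close> of
  \<open>chord (add_mset a A)\<close>.
\<close>

lemma chord_embedding:
  "\<exists>(G :: complex \<Rightarrow> complex) K. surj G \<and> 1 \<le> K \<and> (\<forall>y z. chord A z (dist y z) \<le> K * dist (G y) (G z) \<and>
      dist (G y) (G z) \<le> K * chord A z (dist y z))"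
proof (induction A)
  case empty
  show ?case by (intro exI[of _ id] exI[of _ 1]) (simp add: chord_def)
next
  case (add a A)
  then obtain G :: "complex \<Rightarrow> complex" and K where G: "surj G" "1 \<le> K"
    and lo: "\<And>y z. chord A z (dist y z) \<le> K * dist (G y) (G z)"
    and up: "\<And>y z. dist (G y) (G z) \<le> K * chord A z (dist y z)"
    by blast
  obtain \<psi> where \<psi>: "\<And>t. 0 \<le> t \<Longrightarrow> 0 \<le> \<psi> t" "\<And>t. 0 \<le> t \<Longrightarrow> \<psi> (chord A a t) = t"
    "\<And>t. 0 \<le> t \<Longrightarrow> chord A a (\<psi> t) = t"
    and mono: "\<And>s t. \<lbrakk>0 \<le> s; s \<le> t\<rbrakk> \<Longrightarrow> \<psi> s \<le> \<psi> t"
    and sub: "\<And>t l. \<lbrakk>0 \<le> t; 1 \<le> l\<rbrakk> \<Longrightarrow> \<psi> (l * t) \<le> l * \<psi> t"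
    by (rule superhomogeneous_inverse[of "chord A a", OF continuous_on_chord chord_0 chord_pos
          chord_superhomogeneous]) blast+
  define R :: "complex \<Rightarrow> complex" where "R v = \<psi> (norm v) *\<^sub>R v" for v
  define H where "H y = R (G y - G a)" for y
  have "\<exists>v. R v = w" for w
  proof (cases "w = 0")
    case False
    \<comment> \<open>On the circle of radius \<open>chord A a s\<close> the factor \<open>\<psi>\<close> equals \<open>s\<close>, so the image circle has radius
      \<open>s * chord A a s = chord (add_mset a A) a s\<close>, and this takes every nonnegative value.\<close>
    obtain \<phi> where \<phi>: "\<And>t. 0 \<le> t \<Longrightarrow> 0 \<le> \<phi> t"
      "\<And>t. 0 \<le> t \<Longrightarrow> chord (add_mset a A) a (\<phi> t) = t"
      by (rule superhomogeneous_inverse[of "chord (add_mset a A) a", OF continuous_on_chord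
            chord_0 chord_pos chord_superhomogeneous]) blast+
    define s where "s = \<phi> (norm w)"
    have s: "0 \<le> s" "s * chord A a s = norm w"
      using \<phi> by (auto simp: s_def simp flip: chord_add[of a A a, simplified])
    have "0 \<le> chord A a s"
      using s(1) chord_pos[of s A a] by (cases "s = 0") auto
    then have "R ((chord A a s / norm w) *\<^sub>R w) = w"
      using s False \<psi>(2)[OF s(1)] by (simp add: R_def)
    then show ?thesis ..
  qed (auto simp: R_def intro: exI[of _ 0])
  then have "surj R" by (metis surj_def)
  moreover have "surj (\<lambda>y. G y - G a)"
    using comp_surj[OF G(1) surj_diff_right[of "G a"]] by (simp add: o_def)
  ultimately have "surj H"
    using comp_surj[of "\<lambda>y. G y - G a" R] by (simp add: o_def H_def[abs_def])
  have \<psi>_lo: "dist y a \<le> K * \<psi> (dist (G y) (G a))" for y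
  proof -
    have "dist y a = \<psi> (chord A a (dist y a))"
      by (simp add: \<psi>)
    also have "\<dots> \<le> \<psi> (K * dist (G y) (G a))"
      using chord_pos[of "dist y a" A a] by (intro mono lo) (cases "y = a"; simp)
    also have "\<dots> \<le> K * \<psi> (dist (G y) (G a))"
      using G(2) by (intro sub) auto
    finally show ?thesis .
  qed
  have \<psi>_up: "\<psi> (dist (G y) (G a)) \<le> K * dist y a" for y
  proof -
    have "\<psi> (dist (G y) (G a)) \<le> \<psi> (K * chord A a (dist y a))"
      by (intro mono up) auto
    also have "\<dots> \<le> K * \<psi> (chord A a (dist y a))"
      using G(2) chord_pos[of "dist y a" A a] by (intro sub) (cases "y = a"; simp)
    finally show ?thesis by (simp add: \<psi>)
  qed
  have "chord (add_mset a A) z (dist y z) \<le> 12 * K\<^sup>2 * dist (H y) (H z) \<and>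
        dist (H y) (H z) \<le> 12 * K\<^sup>2 * chord (add_mset a A) z (dist y z)" for y z
  proof -
    define p q where "p = dist (G y) (G a)" and "q = dist (G z) (G a)"
    define M d where "M = \<psi> (max p q)" and "d = max (dist y a) (dist z a)"
    define m where "m = dist y z + dist z a"
    have d0: "0 \<le> d" "0 \<le> m" by (auto simp: d_def m_def le_max_iff_disj)
    have M0: "0 \<le> M" unfolding M_def by (intro \<psi>) (simp add: p_def le_max_iff_disj)
    have C0: "0 \<le> chord A z (dist y z)"
      using chord_pos[of "dist y z" A z] by (cases "y = z"; simp)
    have "\<psi> p \<le> M" "\<psi> q \<le> M" "M = \<psi> p \<or> M = \<psi> q"
      unfolding M_def by (auto intro!: mono simp: p_def q_def max_def)
    moreover have "K * \<psi> p \<le> K * M" "K * \<psi> q \<le> K * M" "K * dist y a \<le> K * d" "K * dist z a \<le> K * d"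
      using calculation G(2) by (auto intro!: mult_left_mono simp: d_def)
    ultimately have Md: "d \<le> K * M" "M \<le> K * d"
      using \<psi>_lo[of y] \<psi>_lo[of z] \<psi>_up[of y] \<psi>_up[of z]
      by (auto simp: d_def p_def q_def)
    have dm: "d \<le> m" "m \<le> 3 * d"
      using dist_triangle[of y a z] dist_triangle2[of y z a] zero_le_dist[of y a]
        zero_le_dist[of z a] by (auto simp: d_def m_def max_def)
    have dist: "M * dist (G y) (G z) \<le> 4 * dist (H y) (H z)"
      "dist (H y) (H z) \<le> 2 * M * dist (G y) (G z)"
      using radial_map_distortion[of \<psi> "G y - G a" "G z - G a", OF \<psi>(1) mono sub]
      by (simp_all add: M_def H_def R_def p_def q_def dist_norm)
    have "m * chord A z (dist y z) \<le> (3 * (K * M)) * (K * dist (G y) (G z))"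
      using dm Md lo[of z y] C0 d0 M0 G(2) by (intro mult_mono) auto
    also have "\<dots> = 3 * K\<^sup>2 * (M * dist (G y) (G z))"
      by (simp add: power2_eq_square)
    also have "\<dots> \<le> 3 * K\<^sup>2 * (4 * dist (H y) (H z))"
      by (intro mult_left_mono dist) simp
    finally have 1: "m * chord A z (dist y z) \<le> 12 * K\<^sup>2 * dist (H y) (H z)" by simp
    have "K * d \<le> K * m" using dm G(2) by simp
    with Md have "M \<le> K * m" by linarith
    then have "dist (H y) (H z) \<le> 2 * (K * m) * (K * chord A z (dist y z))"
      using up[of y z] M0 G(2) d0 by (intro order_trans[OF dist(2)] mult_mono) auto
    also have "\<dots> = 2 * (K\<^sup>2 * (m * chord A z (dist y z)))"
      by (simp add: power2_eq_square)
    also have "\<dots> \<le> 12 * (K\<^sup>2 * (m * chord A z (dist y z)))"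
      using C0 d0 by (intro mult_right_mono) auto
    finally show ?thesis using 1 by (simp add: chord_add m_def mult.assoc)
  qed
  moreover have "1 \<le> 12 * K\<^sup>2"
    using one_le_power[OF G(2), of 2] by linarith
  ultimately show ?case using \<open>surj H\<close> by blast
qed

text \<open>
  The upper bound makes \<open>G\<close> continuous and the lower bound makes it injective; invariance of domain
  then supplies continuity of the inverse.
\<close>

lemma homeomorphism_chord:
  obtains h G :: "complex \<Rightarrow> complex" and K where "homeomorphism UNIV UNIV h G" "1 \<le> K"
    "\<And>y z. chord A z (dist y z) \<le> K * dist (G y) (G z)"
    "\<And>y z. dist (G y) (G z) \<le> K * chord A z (dist y z)"
proof -
  obtain G :: "complex \<Rightarrow> complex" and K where G: "surj G" "1 \<le> K"
    and lo: "\<And>y z. chord A z (dist y z) \<le> K * dist (G y) (G z)"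
    and up: "\<And>y z. dist (G y) (G z) \<le> K * chord A z (dist y z)"
    using chord_embedding[of A] by blast
  have "inj G"
  proof (rule injI)
    fix y z assume "G y = G z"
    then show "y = z"
      using lo[of z y] chord_pos[of "dist y z" A z] by (cases "y = z") auto
  qed
  moreover have "continuous_on UNIV G"
    unfolding continuous_on_def
  proof
    fix z
    have "continuous_on UNIV (\<lambda>y. K * chord A z (dist y z))"
      by (intro continuous_intros continuous_on_compose2[OF continuous_on_chord[of UNIV]]) auto
    then have "((\<lambda>y. K * chord A z (dist y z)) \<longlongrightarrow> 0) (at z)"
      by (metis (mono_tags, lifting) UNIV_I chord_0 continuous_on_def dist_self mult_zero_right)
    then show "(G \<longlongrightarrow> G z) (at z)"
      by (rule metric_tendsto_imp_tendsto)
        (auto intro!: always_eventually order_trans[OF up abs_ge_self])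
  qed
  ultimately obtain h where "homeomorphism UNIV (G ` UNIV) G h"
    using invariance_of_domain_homeomorphism[of UNIV G] by auto
  then have "homeomorphism UNIV UNIV h G"
    using G(1) by (simp add: homeomorphism_symD)
  then show thesis using that G lo up by blast
qed

section \<open>From local to global inclusion of balls\<close>

text \<open>
  Near a point \<open>x\<close>, the image of a small ball is open, and its frontier comes from the bounding
  sphere, which is mapped at distance at least \<open>c * s\<close> from \<open>f x\<close>; a connected ball of radius \<open>c * s\<close>
  around \<open>f x\<close> contains no such frontier point and so lies in the image. For a far target \<open>v\<close>, the
  segment from \<open>f x\<close> to \<open>v\<close> is followed by preimages whose distance from \<open>x\<close> grows at a controlled
  speed: by compactness there is a last parameter that can be reached, and the local statement
  would allow a further step if this parameter were less than 1. Half of the constant \<open>c\<close> is given up so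
  that each step has room within an open ball.
\<close>

lemma local_to_global_co_lipschitz:
  fixes f :: "'a::euclidean_space \<Rightarrow> 'b::euclidean_space"
  assumes cont: "continuous_on UNIV f" and opn: "\<And>U. open U \<Longrightarrow> open (f ` U)"
    and c: "0 < c"
    and expand: "\<And>x. eventually (\<lambda>y. c * dist y x \<le> dist (f y) (f x)) (at x)"
  shows "ball (f x) (c / 2 * r) \<subseteq> f ` ball x r"
proof
  have near: "\<exists>\<delta>>0. \<forall>s. 0 < s \<and> s < \<delta> \<longrightarrow> ball (f x) (c * s) \<subseteq> f ` ball x s" for x
  proof -
    obtain \<delta> where "\<delta> > 0"
      and "\<And>y. \<lbrakk>y \<noteq> x; dist y x < \<delta>\<rbrakk> \<Longrightarrow> c * dist y x \<le> dist (f y) (f x)"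
      using expand[of x] unfolding eventually_at by blast
    then have \<delta>: "\<delta> > 0" "\<And>y. dist y x < \<delta> \<Longrightarrow> c * dist y x \<le> dist (f y) (f x)"
      by (auto, metis dist_self mult_zero_right order_refl)
    have "ball (f x) (c * s) \<subseteq> f ` ball x s" if s: "0 < s" "s < \<delta>" for s
    proof (rule ccontr)
      assume "\<not> ?thesis"
      moreover have "f x \<in> ball (f x) (c * s)" "f x \<in> f ` ball x s"
        using c s by auto
      ultimately have "ball (f x) (c * s) \<inter> frontier (f ` ball x s) \<noteq> {}"
        by (intro connected_Int_frontier) blast+
      then obtain w where w: "dist (f x) w < c * s" "w \<in> closure (f ` ball x s)" "w \<notin> f ` ball x s"
        using opn[of "ball x s"] by (auto simp: frontier_def interior_open)
      have "closed (f ` cball x s)"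
        by (intro compact_imp_closed compact_continuous_image continuous_on_subset[OF cont]) auto
      then have "closure (f ` ball x s) \<subseteq> f ` cball x s"
        by (intro closure_minimal image_mono) auto
      with w obtain y where y: "w = f y" "dist x y \<le> s" by auto
      with w(3) have "dist y x = s" by (auto simp: dist_commute)
      with \<delta>(2)[of y] s y w(1) show False by (simp add: dist_commute)
    qed
    with \<delta>(1) show ?thesis by blast
  qed
  fix v assume v: "v \<in> ball (f x) (c / 2 * r)"
  define d where "d = dist (f x) v"
  have d: "0 \<le> d" "d < c / 2 * r" using v by (auto simp: d_def)
  define \<gamma> where "\<gamma> t = f x + t *\<^sub>R (v - f x)" for t
  \<comment> \<open>The pairs of a parameter \<open>t\<close> and a preimage of \<open>\<gamma> t\<close> reached from \<open>x\<close> at speed \<open>2 * d / c\<close>,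
    which is twice the speed that the local bound asks for.\<close>
  define S where "S = {(t, u). 0 \<le> t \<and> t \<le> 1 \<and> dist x u \<le> 2 * d / c * t \<and> f u = \<gamma> t}"
  have "closed S"
    unfolding S_def \<gamma>_def case_prod_beta
    by (intro closed_Collect_conj closed_Collect_le closed_Collect_eq continuous_intros
        continuous_on_compose2[OF cont]) auto
  moreover have "2 * d / c * t \<le> 2 * d / c" if "t \<le> 1" for t
    using that d c mult_left_mono[of t 1 "2 * d / c"] by simp
  then have "S \<subseteq> {0..1} \<times> cball x (2 * d / c)"
    by (fastforce simp: S_def)
  ultimately have "compact S"
    using compact_Times[of "{0..1::real}" "cball x (2 * d / c)"]
    by (metis compact_Icc compact_cball compact_Int_closed inf.absorb_iff2)
  then have "compact (fst ` S)"
    by (intro compact_continuous_image continuous_intros)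
  moreover have "(0, x) \<in> S"
    by (simp add: S_def \<gamma>_def)
  ultimately obtain T where T: "T \<in> fst ` S" "\<And>t. t \<in> fst ` S \<Longrightarrow> t \<le> T"
    by (metis compact_attains_sup empty_iff image_eqI)
  then obtain u where u: "0 \<le> T" "T \<le> 1" "dist x u \<le> 2 * d / c * T" "f u = \<gamma> T"
    by (auto simp: S_def)
  have "T = 1"
  proof (rule ccontr)
    assume "T \<noteq> 1"
    show False
    proof (cases "d = 0")
      case True
      then have "(1, x) \<in> S" by (auto simp: S_def \<gamma>_def d_def)
      with T(2)[of 1] u \<open>T \<noteq> 1\<close> show False by force
    next
      case False
      with d have dpos: "0 < d" by simp
      obtain \<delta> where \<delta>: "\<delta> > 0" "\<And>s. 0 < s \<and> s < \<delta> \<Longrightarrow> ball (f u) (c * s) \<subseteq> f ` ball u s"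
        using near[of u] by blast
      \<comment> \<open>A step of the segment so short that its target lies within reach of the local statement
        at \<open>u\<close>: the radius \<open>s = 2 * d / c * e\<close> has to stay below \<open>\<delta>\<close>.\<close>
      define e where "e = min (1 - T) (c * \<delta> / (4 * d))"
      have e: "0 < e" "T + e \<le> 1"
        using u \<open>T \<noteq> 1\<close> c \<delta> dpos by (auto simp: e_def)
      define s where "s = 2 * d / c * e"
      have "s \<le> 2 * d / c * (c * \<delta> / (4 * d))"
        unfolding s_def using dpos c by (intro mult_left_mono) (auto simp: e_def)
      also have "\<dots> < \<delta>"
        using dpos c \<delta> by (simp add: field_simps)
      finally have s: "0 < s" "s < \<delta>"
        using dpos c e by (auto simp: s_def)
      have "dist (f u) (\<gamma> (T + e)) = e * d"
        using e by (simp add: u \<gamma>_def dist_norm d_def algebra_simps norm_minus_commute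
            flip: scaleR_diff_right)
      also have "\<dots> < c * s"
        using dpos c e by (simp add: s_def)
      finally obtain u' where u': "f u' = \<gamma> (T + e)" "dist u u' < s"
        using \<delta>(2)[of s] s by (auto simp: subset_iff image_iff)
      have "dist x u' \<le> 2 * d / c * (T + e)"
        using dist_triangle[of x u' u] u u' by (simp add: s_def ring_distribs)
      then have "(T + e, u') \<in> S"
        using u e u' by (simp add: S_def)
      then show False using T(2)[of "T + e"] e by force
    qed
  qed
  with u have "f u = v" "dist x u \<le> 2 * d / c" by (auto simp: \<gamma>_def)
  moreover have "2 * d / c < r" using d c by (simp add: field_simps)
  ultimately show "v \<in> f ` ball x r" by force
qed

section \<open>Comparing polynomial increments with the distance function\<close>

text \<open>
  On the disc of radius \<open>dist y z\<close> about \<open>z\<close> each factor \<open>\<bar>w - a\<bar>\<close> of the derivative is at most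
  \<open>dist y z + dist z a\<close>, so the mean value inequality produces exactly \<open>chord\<close>.
\<close>

lemma poly_dist_le_chord:
  fixes P :: "complex poly"
  assumes P': "pderiv P = smult l (\<Prod>a\<in>#A. [:-a, 1:])"
  shows "dist (poly P y) (poly P z) \<le> norm l * chord A z (dist y z)"
proof -
  define t where "t = dist y z"
  have "norm (poly (pderiv P) w) \<le> norm l * (\<Prod>a\<in>#A. t + dist z a)" if "w \<in> cball z t" for w
  proof -
    have "norm (\<Prod>a\<in>#A. w - a) = (\<Prod>a\<in>#A. dist w a)"
      by (induction A) (auto simp: norm_mult dist_norm)
    also have "\<dots> \<le> (\<Prod>a\<in>#A. t + dist z a)"
      using that by (intro prod_mset_image_mono)
        (auto simp: dist_commute intro: order_trans[OF dist_triangle[of _ _ z]])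
    finally show ?thesis
      by (simp add: P' poly_prod_mset norm_mult mult_left_mono)
  qed
  then have "norm (poly P y - poly P z) \<le> norm l * (\<Prod>a\<in>#A. t + dist z a) * norm (y - z)"
    by (intro field_differentiable_bound[of "cball z t" "poly P" "poly (pderiv P)"])
      (auto simp: t_def dist_commute intro: has_field_derivative_at_within poly_DERIV)
  then show ?thesis
    by (simp add: dist_norm chord_def t_def mult_ac)
qed

text \<open>
  Let \<open>k\<close> be the multiplicity of \<open>z\<close> in \<open>A\<close>. Then \<open>P y - P z = (y - z)^(k+1) T(y)\<close>, and
  differentiating gives \<open>(k + 1) T(z) = l \<cdot> (\<Prod>a\<in>#B. z - a)\<close>, where \<open>B\<close> consists of the elements of
  \<open>A\<close> other than \<open>z\<close>. As \<open>chord A z (dist y z)\<close> is \<open>\<bar>y - z\<bar>^(k+1)\<close> times a factor tending to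
  \<open>\<Prod>a\<in>#B. dist z a\<close>, the ratio of the increment to \<open>chord\<close> tends to \<open>\<bar>l\<bar> / (k + 1)\<close>. This is at
  least \<open>\<bar>l\<bar> / degree P\<close>, whatever \<open>z\<close> is; the factor 2 turns the limit into an inequality that holds
  eventually.
\<close>

lemma chord_le_poly_dist_near:
  fixes P :: "complex poly"
  assumes deg: "degree P > 0" and P': "pderiv P = smult l (\<Prod>a\<in>#A. [:-a, 1:])"
  shows "eventually (\<lambda>y. norm l * chord A z (dist y z)
           \<le> 2 * degree P * dist (poly P y) (poly P z)) (at z)"
proof -
  have P'0: "pderiv P \<noteq> 0" using deg by (simp add: pderiv_eq_0_iff)
  then have l: "l \<noteq> 0" using P' by auto
  define F where "F = P - [:poly P z:]"
  have F: "pderiv F = pderiv P" "poly F z = 0"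
    by (simp_all add: F_def pderiv_diff pderiv_pCons)
  have "F \<noteq> 0" using P'0 F by auto
  obtain T where T: "F = [:-z, 1:] ^ order z F * T" "\<not> [:-z, 1:] dvd T"
    using order_decomp[OF \<open>F \<noteq> 0\<close>] by blast
  obtain k where k: "order z F = Suc k"
    using F \<open>F \<noteq> 0\<close> order_root[of F z] by (cases "order z F") auto
  have Tz: "poly T z \<noteq> 0" using T(2) by (simp add: poly_eq_0_iff_dvd)
  have "degree F = degree P"
    using deg unfolding F_def diff_conv_add_uminus by (intro degree_add_eq_left) simp
  then have kn: "Suc k \<le> degree P"
    using order_degree[OF \<open>F \<noteq> 0\<close>, of z] k by simp
  \<comment> \<open>\<open>S\<close> and \<open>Q\<close> are both the quotient of \<open>P'\<close> by the exact power of \<open>X - z\<close> dividing it, computed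
    from the factorisation of \<open>P - P z\<close> and from the zeros of \<open>P'\<close>. Comparing them at \<open>z\<close>
    identifies \<open>T(z)\<close>.\<close>
  define S where "S = smult (of_nat (Suc k)) T + [:-z, 1:] * pderiv T"
  define B where "B = filter_mset (\<lambda>a. a \<noteq> z) A"
  have A: "A = replicate_mset (count A z) z + B"
    unfolding B_def using multiset_partition[of A "\<lambda>a. a = z"]
    by (simp add: filter_eq_replicate_mset)
  define Q where "Q = smult l (\<Prod>a\<in>#B. [:-a, 1:])"
  have "pderiv P = [:-z, 1:] ^ k * S"
  proof -
    have "pderiv [:-z, 1:] = 1"
      by (simp add: pderiv_pCons)
    then have "pderiv ([:-z, 1:] ^ Suc k) = smult (of_nat (Suc k)) ([:-z, 1:] ^ k)"
      unfolding pderiv_power_Suc by simp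
    moreover have "pderiv P = pderiv ([:-z, 1:] ^ Suc k * T)"
      using T(1) k F(1) by metis
    ultimately show ?thesis
      unfolding pderiv_mult S_def
      by (simp only: distrib_left mult_smult_left mult_smult_right power_Suc mult_ac add_ac)
  qed
  moreover have "pderiv P = [:-z, 1:] ^ count A z * Q"
    unfolding P' Q_def by (subst A) simp
  moreover have Sz: "poly S z \<noteq> 0" "poly S z = Suc k * poly T z"
    using Tz by (simp_all add: S_def del: of_nat_Suc)
  moreover have "poly Q z \<noteq> 0"
    using l by (auto simp: Q_def poly_prod_mset B_def)
  ultimately have "k = count A z"
    using P'0 by (metis (no_types, lifting) order_mult order_power_n_n order_0I add.right_neutral)
  with \<open>pderiv P = [:-z, 1:] ^ k * S\<close> \<open>pderiv P = [:-z, 1:] ^ count A z * Q\<close> have "S = Q"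
    by simp
  have dist_prod: "norm (\<Prod>a\<in>#B. z - a) = (\<Prod>a\<in>#B. dist z a)"
    by (induction B) (auto simp: norm_mult dist_norm)
  have "norm (poly S z) = norm l * (\<Prod>a\<in>#B. dist z a)"
    by (simp add: \<open>S = Q\<close> Q_def poly_prod_mset norm_mult dist_prod)
  then have Tz_eq: "Suc k * norm (poly T z) = norm l * (\<Prod>a\<in>#B. dist z a)"
    unfolding Sz(2) by (simp add: norm_mult del: of_nat_Suc)
  \<comment> \<open>The difference of the two sides of the claim, divided by \<open>dist y z ^ Suc k\<close>.\<close>
  define \<phi> where "\<phi> y = 2 * degree P * norm (poly T y) - norm l * (\<Prod>a\<in>#B. dist y z + dist z a)" for y
  have "Suc k * norm (poly T z) < 2 * degree P * norm (poly T z)"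
    using kn Tz by (intro mult_strict_right_mono) auto
  then have "0 < \<phi> z"
    by (simp add: \<phi>_def flip: Tz_eq)
  moreover have "continuous_on UNIV (\<lambda>y. \<Prod>a\<in>#B. dist y z + dist z a)"
    by (induction B) (auto intro!: continuous_intros)
  then have "continuous_on UNIV \<phi>"
    unfolding \<phi>_def by (intro continuous_intros)
  then have "(\<phi> \<longlongrightarrow> \<phi> z) (at z)"
    by (simp add: continuous_on_def)
  ultimately have "eventually (\<lambda>y. 0 < \<phi> y) (at z)"
    by (intro order_tendstoD(1))
  then show ?thesis
  proof eventually_elim
    case (elim y)
    have "chord A z (dist y z) = dist y z ^ Suc k * (\<Prod>a\<in>#B. dist y z + dist z a)"
      unfolding chord_def \<open>k = count A z\<close> by (subst A) simp
    moreover have "poly P y - poly P z = poly F y"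
      by (simp add: F_def)
    then have "dist (poly P y) (poly P z) = dist y z ^ Suc k * norm (poly T y)"
      unfolding dist_norm by (subst (asm) T(1)) (simp add: k norm_mult norm_power del: power_Suc)
    moreover have "dist y z ^ Suc k * (norm l * (\<Prod>a\<in>#B. dist y z + dist z a))
        \<le> dist y z ^ Suc k * (2 * degree P * norm (poly T y))"
      using elim by (intro mult_left_mono) (auto simp: \<phi>_def)
    ultimately show ?case by (simp only: mult_ac)
  qed
qed

section \<open>Polynomials as Lipschitz quotient mappings\<close>

theorem proposition1p3:
  fixes P :: "complex poly"
  assumes "degree P > 0"
  shows "\<exists>h g :: complex \<Rightarrow> complex.
           homeomorphism UNIV UNIV h g \<and> lipschitz_quotient (poly P \<circ> h)"
proof -
  define A l where "A = proots (pderiv P)" and "l = lead_coeff (pderiv P)"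
  have P': "pderiv P = smult l (\<Prod>a\<in>#A. [:-a, 1:])"
    by (simp add: A_def l_def complex_poly_decompose_multiset)
  have "l \<noteq> 0" using assms by (simp add: l_def pderiv_eq_0_iff)
  obtain h G :: "complex \<Rightarrow> complex" and K where homeo: "homeomorphism UNIV UNIV h G" and K: "1 \<le> K"
    and lo: "\<And>y z. chord A z (dist y z) \<le> K * dist (G y) (G z)"
    and up: "\<And>y z. dist (G y) (G z) \<le> K * chord A z (dist y z)"
    using homeomorphism_chord[of A] by blast
  have Gh: "G (h x) = x" and hG: "h (G y) = y" for x y
    using homeo by (auto simp: homeomorphism_def)
  have conth: "continuous_on UNIV h" and contG: "continuous_on UNIV G"
    using homeo by (auto simp: homeomorphism_def)
  define f where "f = poly P \<circ> h"
  define L where "L = norm l * K"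
  have L: "dist (f x) (f y) \<le> L * dist x y" for x y
  proof -
    have "dist (f x) (f y) \<le> norm l * chord A (h y) (dist (h x) (h y))"
      unfolding f_def o_def by (rule poly_dist_le_chord[OF P'])
    also have "\<dots> \<le> norm l * (K * dist x y)"
      using lo[of "h y" "h x"] by (intro mult_left_mono) (simp_all add: Gh)
    finally show ?thesis by (simp add: L_def)
  qed
  have "0 < L" using \<open>l \<noteq> 0\<close> K by (simp add: L_def)
  define c where "c = norm l / (2 * degree P * K)"
  have "0 < c" using \<open>l \<noteq> 0\<close> K assms by (simp add: c_def)
  have "eventually (\<lambda>y. c * dist y x \<le> dist (f y) (f x)) (at x)" for x
  proof -
    have "filterlim h (at (h x)) (at x)"
    proof -
      have "(h \<longlongrightarrow> h x) (at x)"
        using conth by (simp add: continuous_on_def)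
      moreover have "h y \<noteq> h x" if "y \<noteq> x" for y
        using that Gh by metis
      ultimately show ?thesis
        by (simp add: filterlim_at eventually_at_filter)
    qed
    have "eventually (\<lambda>y. norm l * chord A (h x) (dist (h y) (h x))
           \<le> 2 * degree P * dist (f y) (f x)) (at x)"
      using eventually_compose_filterlim[OF chord_le_poly_dist_near[OF assms P'] \<open>filterlim h _ _\<close>]
      by (simp add: f_def)
    then show ?thesis
    proof eventually_elim
      case (elim y)
      have "norm l * dist y x \<le> norm l * (K * chord A (h x) (dist (h y) (h x)))"
        using up[of "h y" "h x"] by (intro mult_left_mono) (simp_all add: Gh)
      also have "\<dots> \<le> K * (2 * degree P * dist (f y) (f x))"
        using mult_left_mono[OF elim, of K] K by (simp add: mult_ac)
      finally show ?case
        using K assms by (simp add: c_def field_simps)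
    qed
  qed
  moreover have "open (f ` U)" if "open U" for U
  proof -
    have "h ` U = G -` U"
      by (auto simp: Gh intro: image_eqI[where x = "G _"] simp: hG)
    then have "open (h ` U)"
      using contG that by (simp add: continuous_on_open_vimage)
    have "\<not> poly P constant_on UNIV"
    proof
      assume "poly P constant_on UNIV"
      then obtain w where "\<And>y. poly (P - [:w:]) y = 0"
        by (auto simp: constant_on_def)
      then have "P = [:w:]"
        using poly_all_0_iff_0[of "P - [:w:]"] by simp
      with assms show False by simp
    qed
    then have "open (poly P ` h ` U)"
      using \<open>open (h ` U)\<close>
      by (intro open_mapping_thm[of "poly P" UNIV "h ` U"] poly_holomorphic_on) auto
    then show ?thesis by (simp add: f_def image_comp)
  qed
  moreover have "continuous_on UNIV f"
    unfolding f_def using conth by (intro continuous_on_compose) (auto intro: continuous_intros)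
  ultimately have co: "ball (f x) (c / 2 * r) \<subseteq> f ` ball x r" for x r
    using \<open>0 < c\<close> by (intro local_to_global_co_lipschitz) auto
  have "f ` ball x r \<subseteq> ball (f x) (max L (c / 2) * r)" if "0 < r" for x r
  proof clarsimp
    fix y assume "dist x y < r"
    then have "L * dist x y < max L (c / 2) * r"
      using \<open>0 < L\<close> by (intro mult_le_less_imp_less) auto
    then show "dist (f x) (f y) < max L (c / 2) * r"
      using L[of x y] by linarith
  qed
  then have "lipschitz_quotient f"
    unfolding lipschitz_quotient_def
    using co \<open>0 < c\<close> by (intro exI[of _ "c / 2"] exI[of _ "max L (c / 2)"]) auto
  with homeo show ?thesis unfolding f_def by blast
qed

end
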